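(* Let $A\in\mathbb{R}^{n\times n}$, let $q_1$ be the first Schur vector from a Schur decomposition $AQ=QR$ of $A$, with $Aq_1=\lambda_1q_1$, and let $w_1$ be a left eigenvector of $A$ with eigenvalue $\lambda_1$, that is $w_1^TA=\lambda_1w_1^T$. Define $P_1=I-q_1q_1^T$ and $B_1=P_1AP_1$. Let $v_1\in\mathbb{R}^n$ with $\|v_1\|=1$ and $\mathcal{K}_k=\mathrm{span}\{v_1,Av_1,\dots,A^{k-1}v_1\}$, and assume that $\Omega\in\mathbb{R}^{d\times n}$ is an $\epsilon$-embedding for $\mathrm{span}\{\mathcal{K}_k,q_1\}$. If $\cos(w_1,v_1)\ne0$, then $$\|(I-P^\Omega_{\mathcal{K}_k})q_1\|\le\sqrt{\frac{1+\epsilon}{1-\epsilon}}\;\frac{\eta_k}{|\cos(w_1,v_1)|},\qquad \eta_k=\min_{p\in\mathbb{P}^*_{k-1}}\|p(B_1)P_1v_1\|,$$ where $\mathbb{P}^*_{k-1}$ is the set of all polynomials $p$ of degree smaller than or equal to $k-1$ such that $p(\lambda_1)=1$.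
   Context: Norms are Euclidean, and $\cos(w,v)=w^Tv/(\|w\|\,\|v\|)$. A Schur decomposition is $AQ=QR$ with $Q\in\mathbb{R}^{n\times n}$ orthogonal and $R$ block upper triangular with diagonal blocks of size $1\times1$ or $2\times2$; here the first diagonal block is $1\times1$, equal to $\lambda_1$, so that $(q_1,\lambda_1)$ is an eigenpair of $A$. $\Omega$ is an $\epsilon$-embedding for a subspace $\mathcal{S}\subset\mathbb{R}^n$ (with $\epsilon\in[0,1)$) if $(1-\epsilon)\|x\|^2\le\|\Omega x\|^2\le(1+\epsilon)\|x\|^2$ for all $x\in\mathcal{S}$. The projector $P^\Omega_{\mathcal{K}_k}$ onto $\mathcal{K}_k$ is defined by $P^\Omega_{\mathcal{K}_k}x=\arg\min_{y\in\mathcal{K}_k}\|\Omega(x-y)\|$ for $x\in\mathbb{R}^n$. The Krylov subspace $\mathcal{K}_k$ has dimension $k$. *)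

theory Defs
  imports "HOL-Analysis.Analysis" "HOL-Computational_Algebra.Polynomial"
begin

(* Schur vectors are ordered, so the index type carries a linear order; the row and column
   indices are listed increasingly. The numeral types (CARD = n) provide such a type for
   every n >= 1. *)
definition first_index :: "'n::{finite,wellorder}" where
  "first_index = Min UNIV"

(* The block partition is given by a monotone labelling b of the indices: i and j belong to the
   same diagonal block iff b i = b j. Labels may be skipped, so a fibre of b may be empty. *)
definition block_upper_triangular ::
    "real^'n::{finite,wellorder}^'n::{finite,wellorder} \<Rightarrow> ('n::{finite,wellorder} \<Rightarrow> nat) \<Rightarrow> bool" where
  "block_upper_triangular R b \<longleftrightarrow>
     mono b \<and> (\<forall>i j. b j < b i \<longrightarrow> R $ i $ j = 0)"

definition schur_decomposition ::
    "real^'n::{finite,wellorder}^'n::{finite,wellorder} \<Rightarrow> real^'n::{finite,wellorder}^'n::{finite,wellorder}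
     \<Rightarrow> real^'n::{finite,wellorder}^'n::{finite,wellorder} \<Rightarrow> ('n::{finite,wellorder} \<Rightarrow> nat) \<Rightarrow> bool" where
  "schur_decomposition A Q R b \<longleftrightarrow>
     orthogonal_matrix Q \<and> A ** Q = Q ** R \<and>
     block_upper_triangular R b \<and> (\<forall>m. card {i. b i = m} \<le> 2)"

definition left_eigenvector :: "real^'n^'n \<Rightarrow> real \<Rightarrow> real^'n \<Rightarrow> bool" where
  "left_eigenvector A \<mu> w \<longleftrightarrow> w \<noteq> 0 \<and> w v* A = \<mu> *\<^sub>R w"

definition vec_cos :: "real^'n \<Rightarrow> real^'n \<Rightarrow> real" where
  "vec_cos w v = (w \<bullet> v) / (norm w * norm v)"

definition outer_product :: "real^'n \<Rightarrow> real^'n \<Rightarrow> real^'n^'n" where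
  "outer_product u v = (\<chi> i j. u $ i * v $ j)"

(* The library's * and ^ on vectors of vectors act entrywise, hence the explicit iteration
   of the matrix product. *)
definition matrix_power :: "real^'n^'n \<Rightarrow> nat \<Rightarrow> real^'n^'n" where
  "matrix_power A i = (((**) A) ^^ i) (mat 1)"

definition matrix_poly :: "real poly \<Rightarrow> real^'n^'n \<Rightarrow> real^'n^'n" where
  "matrix_poly p A = (\<Sum>i\<le>degree p. coeff p i *\<^sub>R matrix_power A i)"

definition krylov :: "real^'n^'n \<Rightarrow> real^'n \<Rightarrow> nat \<Rightarrow> (real^'n) set" where
  "krylov A v k = span ((\<lambda>i. matrix_power A i *v v) ` {..<k})"

definition eps_embedding :: "real \<Rightarrow> real^'n^'d \<Rightarrow> (real^'n) set \<Rightarrow> bool" where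
  "eps_embedding \<epsilon> \<Omega> S \<longleftrightarrow> 0 \<le> \<epsilon> \<and> \<epsilon> < 1 \<and>
     (\<forall>x\<in>S. (1 - \<epsilon>) * (norm x)\<^sup>2 \<le> (norm (\<Omega> *v x))\<^sup>2 \<and>
             (norm (\<Omega> *v x))\<^sup>2 \<le> (1 + \<epsilon>) * (norm x)\<^sup>2)"

definition sketched_projector :: "real^'n^'d \<Rightarrow> (real^'n) set \<Rightarrow> real^'n \<Rightarrow> real^'n" where
  "sketched_projector \<Omega> K x = arg_min_on (\<lambda>y. norm (\<Omega> *v (x - y))) K"

definition normalized_polys :: "nat \<Rightarrow> real \<Rightarrow> real poly set" where
  "normalized_polys m \<mu> = {p. degree p \<le> m \<and> poly p \<mu> = 1}"

(* LEAST (rather than Inf) makes this an attained minimum; the value is unspecified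
   unless the minimum exists. *)
definition min_poly_norm :: "nat \<Rightarrow> real \<Rightarrow> real^'n^'n \<Rightarrow> real^'n \<Rightarrow> real" where
  "min_poly_norm m \<mu> B u =
     (LEAST r. r \<in> (\<lambda>p. norm (matrix_poly p B *v u)) ` normalized_polys m \<mu>)"

end

theory Submission
  imports Defs
begin

text \<open>
  Write \<open>q\<close>, \<open>w\<close>, \<open>v\<close> for the first Schur vector, the left eigenvector and the starting vector.
  For a polynomial \<open>p\<close> with \<open>p(\<lambda>) = 1\<close> and degree below \<open>k\<close> put \<open>x = p(A) v\<close>, a vector of the
  Krylov space. Two facts about \<open>x\<close> carry the proof.

  \<^item> Its component orthogonal to \<open>q\<close> is \<open>P x = p(B) P v\<close>. Since \<open>q\<close> is an eigenvector, \<open>P A q = 0\<close>,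
    and so \<open>P A = B P\<close> (\<open>deflation_intertwines\<close>); an intertwining relation passes to polynomials
    (\<open>matrix_poly_intertwine\<close>).
  \<^item> It is not small: \<open>w \<bullet> x = p(\<lambda>) (w \<bullet> v) = w \<bullet> v\<close> (\<open>left_eigenvector_matrix_poly\<close>), so by the
    Cauchy-Schwarz inequality \<open>norm x\<close> is at least the absolute cosine of \<open>w\<close> and \<open>v\<close>.

  The point of the line through \<open>x\<close> that is nearest to \<open>q\<close> is at distance \<open>norm (P x) / norm x\<close>, the
  sine of the angle between \<open>q\<close> and \<open>x\<close> (\<open>norm_diff_line_projection\<close>). Thus
  the Euclidean distance from \<open>q\<close> to the Krylov space is at most
  \<open>norm (p(B) P v)\<close> divided by that cosine. Bounding the distance to the line, rather than the error
  of the multiple of \<open>x\<close> whose \<open>q\<close>-component equals \<open>q\<close>, is what makes the bound hold with the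
  cosine of \<open>w\<close> and \<open>v\<close>, even when \<open>w\<close> is orthogonal to \<open>q\<close>.

  The sketched projection is optimal for the sketched norm, and passing to that norm and back costs
  the factor \<open>sqrt ((1 + \<epsilon>) / (1 - \<epsilon>))\<close> (\<open>sketched_projector_quasi_optimal\<close>). It remains to take for
  \<open>p\<close> a minimizer, which exists because the vectors \<open>p(B) P v\<close> form an affine subspace of a
  finite-dimensional space (\<open>min_poly_norm_attained\<close>).
\<close>

section \<open>Polynomials in a matrix\<close>

lemma matrix_power_0_vector: "matrix_power A 0 *v x = x"
  by (simp add: matrix_power_def)

lemma matrix_power_Suc_vector: "matrix_power A (Suc i) *v x = A *v (matrix_power A i *v x)"
  by (simp add: matrix_power_def matrix_vector_mul_assoc)

lemma matrix_poly_vector_eq_sum: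
  fixes A :: "real^'n^'n"
  shows "matrix_poly p A *v x = (\<Sum>i\<le>degree p. coeff p i *\<^sub>R (matrix_power A i *v x))"
proof -
  have "(\<Sum>i\<in>S. c i *\<^sub>R M i) *v x = (\<Sum>i\<in>S. c i *\<^sub>R (M i *v x))"
    if "finite S" for S :: "nat set" and c :: "nat \<Rightarrow> real" and M :: "nat \<Rightarrow> real^'n^'n"
    using that
    by (induction S) (simp_all add: matrix_vector_mult_add_rdistrib scaleR_matrix_vector_assoc)
  then show ?thesis
    by (simp add: matrix_poly_def)
qed

text \<open>Padding to a common range of summation makes the polynomials of bounded degree act linearly.\<close>

lemma matrix_poly_vector_eq_sum_bounded:
  assumes "degree p \<le> m"
  shows "matrix_poly p A *v x = (\<Sum>i\<le>m. coeff p i *\<^sub>R (matrix_power A i *v x))"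
  unfolding matrix_poly_vector_eq_sum
  by (rule sum.mono_neutral_left) (use assms in \<open>auto simp: coeff_eq_0\<close>)

lemma matrix_poly_add_vector:
  "matrix_poly (p + q) A *v x = matrix_poly p A *v x + matrix_poly q A *v x"
proof -
  define m where "m = max (degree p) (degree q)"
  have "degree (p + q) \<le> m" "degree p \<le> m" "degree q \<le> m"
    by (auto simp: m_def degree_add_le)
  then show ?thesis
    by (simp add: matrix_poly_vector_eq_sum_bounded sum.distrib scaleR_left_distrib)
qed

lemma matrix_poly_smult_vector: "matrix_poly (smult c p) A *v x = c *\<^sub>R (matrix_poly p A *v x)"
  by (simp add: matrix_poly_vector_eq_sum_bounded[OF degree_smult_le]
      matrix_poly_vector_eq_sum scaleR_sum_right)

lemma matrix_poly_1_vector: "matrix_poly 1 A *v x = x"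
  by (simp add: matrix_poly_vector_eq_sum matrix_power_0_vector)

lemma matrix_poly_intertwine:
  assumes "\<And>x. P *v (A *v x) = B *v (P *v x)"
  shows "P *v (matrix_poly p A *v x) = matrix_poly p B *v (P *v x)"
proof -
  have "P *v (matrix_power A i *v x) = matrix_power B i *v (P *v x)" for i
    by (induction i) (simp_all add: matrix_power_0_vector matrix_power_Suc_vector assms)
  then show ?thesis
    by (simp add: matrix_poly_vector_eq_sum linear_sum[OF matrix_vector_mul_linear] matrix_vector_mult_scaleR)
qed

lemma left_eigenvector_matrix_poly:
  assumes "left_eigenvector A \<mu> w"
  shows "w \<bullet> (matrix_poly p A *v x) = poly p \<mu> * (w \<bullet> x)"
proof -
  have step: "w \<bullet> (A *v y) = \<mu> * (w \<bullet> y)" for y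
    using assms by (simp add: left_eigenvector_def flip: dot_lmul_matrix)
  have "w \<bullet> (matrix_power A i *v x) = \<mu> ^ i * (w \<bullet> x)" for i
    by (induction i) (simp_all add: matrix_power_0_vector matrix_power_Suc_vector step)
  then show ?thesis
    by (simp add: matrix_poly_vector_eq_sum inner_sum_right poly_altdef sum_distrib_right mult.assoc)
qed

lemma matrix_poly_in_krylov:
  assumes "degree p < k"
  shows "matrix_poly p A *v v \<in> krylov A v k"
  unfolding matrix_poly_vector_eq_sum krylov_def
  using assms by (intro span_sum span_scale span_base imageI) auto

section \<open>Deflation of an eigenvector\<close>

lemma outer_product_vector: "outer_product u v *v x = (v \<bullet> x) *\<^sub>R u"
  by (simp add: outer_product_def matrix_vector_mult_def inner_vec_def vec_eq_iff
      sum_distrib_left mult_ac)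

lemma complement_projector_vector:
  "(mat 1 - outer_product q q) *v x = x - (q \<bullet> x) *\<^sub>R q"
  by (simp add: matrix_vector_mult_diff_rdistrib outer_product_vector)

text \<open>
  Splitting \<open>x\<close> into its parts along and orthogonal to \<open>q\<close>, the matrix \<open>P A\<close> annihilates the former
  because \<open>A q\<close> is again a multiple of \<open>q\<close>.
\<close>

lemma deflation_intertwines:
  fixes A :: "real^'n^'n"
  assumes "norm q = 1" and "A *v q = \<mu> *\<^sub>R q" and P: "P = mat 1 - outer_product q q"
  shows "P *v (A *v x) = (P ** A ** P) *v (P *v x)"
proof -
  have qq: "q \<bullet> q = 1"
    using assms(1) by (simp add: dot_square_norm)
  have Pq: "P *v q = 0" and PP: "P *v (P *v x) = P *v x"
    by (simp_all add: P complement_projector_vector inner_diff_right qq)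
  have "(P ** A ** P) *v (P *v x) = P *v (A *v (P *v x))"
    by (simp add: PP flip: matrix_vector_mul_assoc)
  also have "\<dots> = P *v (A *v (x - (q \<bullet> x) *\<^sub>R q))"
    by (simp add: P complement_projector_vector)
  also have "\<dots> = P *v (A *v x)"
    by (simp add: matrix_vector_mult_diff_distrib matrix_vector_mult_scaleR assms(2) Pq)
  finally show ?thesis ..
qed

text \<open>
  Both sides are the sine of the angle between \<open>q\<close> and \<open>x\<close>: on the left as a distance from the unit
  vector \<open>q\<close> to the line through \<open>x\<close>, on the right as a relative distance from \<open>x\<close> to the line
  through \<open>q\<close>.
\<close>

lemma norm_diff_line_projection:
  fixes q x :: "'a::real_inner"
  assumes "norm q = 1" and "x \<noteq> 0"
  shows "norm (q - ((q \<bullet> x) / (x \<bullet> x)) *\<^sub>R x) = norm (x - (q \<bullet> x) *\<^sub>R q) / norm x"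
proof (rule power2_eq_imp_eq)
  have qq: "q \<bullet> q = 1"
    using assms(1) by (simp add: dot_square_norm)
  have xx: "x \<bullet> x \<noteq> 0"
    using assms(2) by simp
  show "(norm (q - ((q \<bullet> x) / (x \<bullet> x)) *\<^sub>R x))\<^sup>2 = (norm (x - (q \<bullet> x) *\<^sub>R q) / norm x)\<^sup>2"
    using xx unfolding power_divide power2_norm_eq_inner
    by (simp add: inner_diff_left inner_diff_right qq inner_commute[of x q] field_simps)
qed simp_all

section \<open>Attained minima\<close>

text \<open>
  The polynomials of degree at most \<open>m\<close> with value \<open>1\<close> at \<open>\<mu>\<close> are \<open>1 + s\<close>, where \<open>s\<close> runs over the
  linear space of those that vanish at \<open>\<mu>\<close>. Hence the vectors \<open>p(B) u\<close> form a translate by \<open>u\<close> of a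
  subspace \<open>T\<close> of \<open>\<real>\<^sup>n\<close>. Being closed, \<open>T\<close> has a point nearest to \<open>- u\<close>, and this point gives the
  minimum.
\<close>

lemma min_poly_norm_attained:
  fixes B :: "real^'n^'n"
  obtains p where "p \<in> normalized_polys m \<mu>" and "min_poly_norm m \<mu> B u = norm (matrix_poly p B *v u)"
proof -
  define T where "T = (\<lambda>p. matrix_poly p B *v u) ` {p. degree p \<le> m \<and> poly p \<mu> = 0}"
  have "subspace T"
    unfolding subspace_def
  proof (intro conjI ballI allI)
    show "0 \<in> T"
      unfolding T_def by (rule image_eqI[of _ _ 0]) (simp_all add: matrix_poly_def)
    show "x + y \<in> T" if xy: "x \<in> T" "y \<in> T" for x y
    proof -
      obtain p q where "x = matrix_poly p B *v u" "y = matrix_poly q B *v u"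
        "degree p \<le> m" "poly p \<mu> = 0" "degree q \<le> m" "poly q \<mu> = 0"
        using xy by (auto simp: T_def)
      then show ?thesis
        unfolding T_def
        by (intro image_eqI[of _ _ "p + q"]) (simp_all add: matrix_poly_add_vector degree_add_le)
    qed
    show "c *\<^sub>R x \<in> T" if x: "x \<in> T" for c x
    proof -
      obtain p where "x = matrix_poly p B *v u" "degree p \<le> m" "poly p \<mu> = 0"
        using x by (auto simp: T_def)
      then show ?thesis
        unfolding T_def
        by (intro image_eqI[of _ _ "smult c p"])
          (auto simp: matrix_poly_smult_vector intro: order_trans[OF degree_smult_le])
    qed
  qed
  then obtain y where y: "y \<in> T" "\<And>z. z \<in> T \<Longrightarrow> dist (- u) y \<le> dist (- u) z"
    using distance_attains_inf[OF closed_subspace, of T "- u"] subspace_0 by blast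
  then obtain r where r: "y = matrix_poly r B *v u" "degree r \<le> m" "poly r \<mu> = 0"
    by (auto simp: T_def)
  have shift: "dist (- u) (matrix_poly s B *v u) = norm (matrix_poly (1 + s) B *v u)" for s
    using norm_minus_cancel[of "u + matrix_poly s B *v u"]
    by (simp add: matrix_poly_add_vector matrix_poly_1_vector dist_norm)
  have opt: "norm (matrix_poly (1 + r) B *v u) \<le> norm (matrix_poly p B *v u)"
    if "p \<in> normalized_polys m \<mu>" for p
  proof -
    have "matrix_poly (p - 1) B *v u \<in> T"
      using that by (auto simp: T_def normalized_polys_def intro!: imageI degree_diff_le)
    from y(2)[OF this] show ?thesis
      by (simp add: r shift)
  qed
  have mem: "1 + r \<in> normalized_polys m \<mu>"
    using r by (simp add: normalized_polys_def degree_add_le)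
  moreover have "min_poly_norm m \<mu> B u = norm (matrix_poly (1 + r) B *v u)"
    unfolding min_poly_norm_def by (rule Least_equality) (use mem opt in auto)
  ultimately show thesis ..
qed

text \<open>
  A minimizer exists because the image of \<open>K\<close> under \<open>\<Omega>\<close> is a closed set. If \<open>\<Omega>\<close> is not injective on
  \<open>K\<close>, there are several, and the projection is some choice among them.
\<close>

lemma sketched_projector_optimal:
  fixes \<Omega> :: "real^'n^'d"
  assumes "subspace K"
  shows "sketched_projector \<Omega> K x \<in> K"
    and "y \<in> K \<Longrightarrow> norm (\<Omega> *v (x - sketched_projector \<Omega> K x)) \<le> norm (\<Omega> *v (x - y))"
proof -
  have "closed ((*v) \<Omega> ` K)"
    by (intro closed_subspace linear_subspace_image assms matrix_vector_mul_linear)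
  moreover have "(*v) \<Omega> ` K \<noteq> {}"
    using subspace_0[OF assms] by auto
  ultimately obtain t where "t \<in> (*v) \<Omega> ` K"
    "\<And>s. s \<in> (*v) \<Omega> ` K \<Longrightarrow> dist (\<Omega> *v x) t \<le> dist (\<Omega> *v x) s"
    by (rule distance_attains_inf[where a = "\<Omega> *v x"]) blast
  then obtain z where "z \<in> K"
    "\<And>y. y \<in> K \<Longrightarrow> dist (\<Omega> *v x) (\<Omega> *v z) \<le> dist (\<Omega> *v x) (\<Omega> *v y)"
    by blast
  then have "is_arg_min (\<lambda>y. norm (\<Omega> *v (x - y))) (\<lambda>y. y \<in> K) z"
    by (simp add: is_arg_min_linorder dist_norm matrix_vector_mult_diff_distrib)
  then have "is_arg_min (\<lambda>y. norm (\<Omega> *v (x - y))) (\<lambda>y. y \<in> K) (sketched_projector \<Omega> K x)"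
    unfolding sketched_projector_def arg_min_on_def arg_min_def by (rule someI)
  then show "sketched_projector \<Omega> K x \<in> K"
    and "y \<in> K \<Longrightarrow> norm (\<Omega> *v (x - sketched_projector \<Omega> K x)) \<le> norm (\<Omega> *v (x - y))"
    by (auto simp: is_arg_min_linorder)
qed

text \<open>
  The lower embedding bound passes from the error of the projection to its sketch, optimality
  from there to the sketch of \<open>x - y\<close>, and the upper embedding bound from there back to \<open>x - y\<close>.
  Both bounds concern differences of \<open>x\<close> and a point of \<open>K\<close>, so the embedded subspace has to
  contain \<open>x\<close> besides \<open>K\<close>.
\<close>

lemma sketched_projector_quasi_optimal:
  fixes \<Omega> :: "real^'n^'d"
  assumes K: "subspace K" and emb: "eps_embedding \<epsilon> \<Omega> (span (K \<union> {x}))" and "y \<in> K"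
  shows "norm (x - sketched_projector \<Omega> K x) \<le> sqrt ((1 + \<epsilon>) / (1 - \<epsilon>)) * norm (x - y)"
proof -
  define z where "z = sketched_projector \<Omega> K x"
  have z: "z \<in> K" "norm (\<Omega> *v (x - z)) \<le> norm (\<Omega> *v (x - y))"
    using sketched_projector_optimal[OF K] \<open>y \<in> K\<close> by (auto simp: z_def)
  have diff: "x - t \<in> span (K \<union> {x})" if "t \<in> K" for t
    using that by (intro span_diff span_base) auto
  have \<epsilon>: "0 \<le> \<epsilon>" "\<epsilon> < 1"
    using emb by (auto simp: eps_embedding_def)
  have "(1 - \<epsilon>) * (norm (x - z))\<^sup>2 \<le> (norm (\<Omega> *v (x - z)))\<^sup>2"
    using emb diff[OF z(1)] by (auto simp: eps_embedding_def)
  also have "\<dots> \<le> (norm (\<Omega> *v (x - y)))\<^sup>2"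
    using z(2) by (intro power_mono) auto
  also have "\<dots> \<le> (1 + \<epsilon>) * (norm (x - y))\<^sup>2"
    using emb diff[OF \<open>y \<in> K\<close>] by (auto simp: eps_embedding_def)
  finally have "(norm (x - z))\<^sup>2 \<le> (1 + \<epsilon>) / (1 - \<epsilon>) * (norm (x - y))\<^sup>2"
    using \<epsilon> by (simp add: field_simps)
  then have "norm (x - z) \<le> sqrt ((1 + \<epsilon>) / (1 - \<epsilon>) * (norm (x - y))\<^sup>2)"
    by (rule real_le_rsqrt)
  then show ?thesis
    by (simp only: real_sqrt_mult real_sqrt_abs abs_norm_cancel z_def)
qed

section \<open>The error of the sketched projection\<close>

theorem proposition5p3:
  fixes A Q R P\<^sub>1 B\<^sub>1 :: "real^'n::{finite,wellorder}^'n::{finite,wellorder}"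
    and b :: "'n::{finite,wellorder} \<Rightarrow> nat"
    and q\<^sub>1 w\<^sub>1 v\<^sub>1 :: "real^'n::{finite,wellorder}"
    and \<Omega> :: "real^'n::{finite,wellorder}^'d"
    and lam\<^sub>1 \<epsilon> :: real
    and k :: nat
  assumes schur: "schur_decomposition A Q R b"
    and first_block: "{i. b i = b first_index} = {first_index}"
    and first_block_entry: "R $ first_index $ first_index = lam\<^sub>1"
    and q1: "q\<^sub>1 = column first_index Q"
    and eigenpair: "A *v q\<^sub>1 = lam\<^sub>1 *\<^sub>R q\<^sub>1"
    and left: "left_eigenvector A lam\<^sub>1 w\<^sub>1"
    and P1: "P\<^sub>1 = mat 1 - outer_product q\<^sub>1 q\<^sub>1"
    and B1: "B\<^sub>1 = P\<^sub>1 ** A ** P\<^sub>1"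
    and v1: "norm v\<^sub>1 = 1"
    and k: "1 \<le> k"
    and dim_krylov: "dim (krylov A v\<^sub>1 k) = k"
    and embedding: "eps_embedding \<epsilon> \<Omega> (span (krylov A v\<^sub>1 k \<union> {q\<^sub>1}))"
    and cos: "vec_cos w\<^sub>1 v\<^sub>1 \<noteq> 0"
  shows "norm (q\<^sub>1 - sketched_projector \<Omega> (krylov A v\<^sub>1 k) q\<^sub>1)
    \<le> sqrt ((1 + \<epsilon>) / (1 - \<epsilon>))
        * (min_poly_norm (k - 1) lam\<^sub>1 B\<^sub>1 (P\<^sub>1 *v v\<^sub>1) / \<bar>vec_cos w\<^sub>1 v\<^sub>1\<bar>)"
proof -
  define c where "c = \<bar>vec_cos w\<^sub>1 v\<^sub>1\<bar>"
  have c: "c > 0"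
    using cos by (simp add: c_def)
  have norm_q: "norm q\<^sub>1 = 1"
    using schur by (simp add: q1 schur_decomposition_def orthogonal_matrix_orthonormal_columns)
  have w: "w\<^sub>1 \<noteq> 0"
    using left by (simp add: left_eigenvector_def)
  obtain p where p: "degree p \<le> k - 1" "poly p lam\<^sub>1 = 1"
    and min: "min_poly_norm (k - 1) lam\<^sub>1 B\<^sub>1 (P\<^sub>1 *v v\<^sub>1) = norm (matrix_poly p B\<^sub>1 *v (P\<^sub>1 *v v\<^sub>1))"
    using min_poly_norm_attained[of "k - 1" lam\<^sub>1 B\<^sub>1 "P\<^sub>1 *v v\<^sub>1"]
    by (auto simp: normalized_polys_def)
  define x where "x = matrix_poly p A *v v\<^sub>1"
  have x_in: "x \<in> krylov A v\<^sub>1 k"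
    using p(1) k by (auto simp: x_def intro: matrix_poly_in_krylov)
  have "P\<^sub>1 *v x = matrix_poly p B\<^sub>1 *v (P\<^sub>1 *v v\<^sub>1)"
    unfolding x_def B1
    by (rule matrix_poly_intertwine) (rule deflation_intertwines[OF norm_q eigenpair P1])
  moreover have "P\<^sub>1 *v x = x - (q\<^sub>1 \<bullet> x) *\<^sub>R q\<^sub>1"
    by (simp add: P1 complement_projector_vector)
  ultimately have perp: "norm (x - (q\<^sub>1 \<bullet> x) *\<^sub>R q\<^sub>1) = min_poly_norm (k - 1) lam\<^sub>1 B\<^sub>1 (P\<^sub>1 *v v\<^sub>1)"
    by (simp only: min)
  have "w\<^sub>1 \<bullet> x = w\<^sub>1 \<bullet> v\<^sub>1"
    by (simp add: x_def left_eigenvector_matrix_poly[OF left] p(2))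
  \<comment> \<open>As \<open>norm v\<^sub>1 = 1\<close>, the left-hand side is \<open>\<bar>w\<^sub>1 \<bullet> x\<bar>\<close>.\<close>
  then have "norm w\<^sub>1 * c \<le> norm w\<^sub>1 * norm x"
    using Cauchy_Schwarz_ineq2[of w\<^sub>1 x] w by (simp add: c_def vec_cos_def v1)
  then have c_le: "c \<le> norm x"
    using w by simp
  define y where "y = ((q\<^sub>1 \<bullet> x) / (x \<bullet> x)) *\<^sub>R x"
  have "norm (q\<^sub>1 - y) = norm (x - (q\<^sub>1 \<bullet> x) *\<^sub>R q\<^sub>1) / norm x"
    unfolding y_def by (rule norm_diff_line_projection[OF norm_q]) (use c c_le in auto)
  also have "\<dots> \<le> norm (x - (q\<^sub>1 \<bullet> x) *\<^sub>R q\<^sub>1) / c"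
    using c c_le by (intro divide_left_mono) (auto intro: mult_pos_pos less_le_trans)
  finally have y_dist: "norm (q\<^sub>1 - y) \<le> min_poly_norm (k - 1) lam\<^sub>1 B\<^sub>1 (P\<^sub>1 *v v\<^sub>1) / c"
    by (simp add: perp)
  have sub: "subspace (krylov A v\<^sub>1 k)"
    by (simp add: krylov_def)
  have "y \<in> krylov A v\<^sub>1 k"
    unfolding y_def by (intro subspace_scale sub x_in)
  from sketched_projector_quasi_optimal[OF sub embedding this]
  have "norm (q\<^sub>1 - sketched_projector \<Omega> (krylov A v\<^sub>1 k) q\<^sub>1)
      \<le> sqrt ((1 + \<epsilon>) / (1 - \<epsilon>)) * norm (q\<^sub>1 - y)" .
  also have "\<dots> \<le> sqrt ((1 + \<epsilon>) / (1 - \<epsilon>))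
      * (min_poly_norm (k - 1) lam\<^sub>1 B\<^sub>1 (P\<^sub>1 *v v\<^sub>1) / c)"
    using embedding by (intro mult_left_mono y_dist) (auto simp: eps_embedding_def)
  finally show ?thesis
    by (simp add: c_def)
qed

end
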